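(* Let $\beta>\alpha>0$. Then the Wright function $W_{\alpha,\beta}$ has the integral representation $$W_{\alpha,\beta}(z)=c_{\alpha,\beta}\int_0^1(1-t^{1/\alpha})^{\beta-\alpha-1}W_{\alpha,\alpha}(zt)\,dt,\qquad z\in\mathbb{R},$$ where $c_{\alpha,\beta}=\frac{1}{\alpha\Gamma(\beta-\alpha)}$. In particular, $$W_{\alpha,\alpha+1}(z)=\frac{1}{\alpha}\int_0^1W_{\alpha,\alpha}(zt)\,dt .$$
   Context: $\Gamma$ is the Gamma function. The Wright function is $W_{\alpha,\beta}(z)=\sum_{k=0}^\infty\frac{z^k}{k!\,\Gamma(\alpha k+\beta)}$. *)

theory Defs
  imports "HOL-Analysis.Analysis"
begin

(* At the poles of Gamma, where the coefficient 1 / Gamma is 0, the library has Gamma x = 0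
   and hence the quotient is 0 as well. *)
definition wright :: "real \<Rightarrow> real \<Rightarrow> real \<Rightarrow> real" where
  "wright \<alpha> \<beta> z = (\<Sum>k. z ^ k / (fact k * Gamma (\<alpha> * real k + \<beta>)))"

end

theory Submission imports Defs begin

text \<open>
  Integrate the series of \<open>W\<^bsub>\<alpha>,\<alpha>\<^esub>(zt)\<close> term by term against the weight. The substitution
  \<open>t = u powr \<alpha>\<close> turns the \<open>k\<close>-th moment of the weight into \<open>\<alpha>\<close> times the Beta integral
  \<open>B(\<alpha>k + \<alpha>, \<beta> - \<alpha>)\<close>, and the Gamma factors of that Beta value exchange
  \<open>\<Gamma>(\<alpha>k + \<alpha>)\<close> for \<open>\<Gamma>(\<alpha>k + \<beta>)\<close>. The interchange is justified since the absolute values of the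
  integrated terms are those of an exponential series divided by Gamma values, and Gamma is
  bounded away from \<open>0\<close> on the positive axis. The second formula is the case \<open>\<beta> = \<alpha> + 1\<close>, where
  the weight is \<open>1\<close>.
\<close>

text \<open>On \<open>{1..2}\<close> alone the Gamma integrand is already large enough: since
  \<open>x - 1 > -1\<close> and \<open>t \<ge> 1\<close>, the power is at least
  \<open>1 / t \<ge> 1 / 2\<close>, and the exponential factor is at least \<open>exp (-2)\<close>.
  The bound does not depend on \<open>x\<close>, so it serves all terms of the Wright series at
  once.\<close>

lemma Gamma_real_lower_bound:
  fixes x :: real
  assumes "x > 0"
  shows "exp (-2) / 2 \<le> Gamma x"
proof -
  note G = Gamma_integral_real[OF assms]
  have int: "(\<lambda>t. t powr (x - 1) / exp t) integrable_on {1..2}"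
    using assms by (intro integrable_continuous_real continuous_intros) auto
  have le: "exp (-2) / 2 \<le> t powr (x - 1) / exp t" if "t \<in> {1..2}" for t :: real
  proof -
    have "1 / 2 \<le> t powr -1"
      using that by (simp add: powr_minus field_simps)
    also have "\<dots> \<le> t powr (x - 1)"
      using that assms by (intro powr_mono) auto
    finally have "1 / 2 * exp (-2) \<le> t powr (x - 1) * exp (-t)"
      using that by (intro mult_mono) auto
    then show ?thesis
      by (simp add: exp_minus field_simps)
  qed
  have "exp (-2) / 2 = integral {1..2} (\<lambda>_::real. exp (-2) / 2 :: real)"
    by simp
  also have "\<dots> \<le> integral {1..2} (\<lambda>t. t powr (x - 1) / exp t)"
    by (intro integral_le int le) auto
  also have "\<dots> \<le> integral {0..} (\<lambda>t. t powr (x - 1) / exp t)"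
    using G int by (intro integral_subset_le) (auto simp: has_integral_iff)
  also have "\<dots> = Gamma x"
    using G by (simp add: has_integral_iff)
  finally show ?thesis .
qed

lemma summable_wright:
  fixes \<alpha> \<beta> z :: real
  assumes "0 < \<alpha>" and "0 < \<beta>"
  shows "summable (\<lambda>k. norm (z ^ k / (fact k * Gamma (\<alpha> * real k + \<beta>))))"
proof (rule summable_comparison_test')
  \<comment> \<open>The factor \<open>2 * exp 2\<close> is the reciprocal of the lower bound for
    Gamma.\<close>
  show "summable (\<lambda>k. (\<bar>z\<bar> ^ k /\<^sub>R fact k) * (2 * exp 2))"
    by (intro summable_mult2 summable_exp_generic)
  fix k :: nat
  have pos: "0 < \<alpha> * real k + \<beta>"
    using assms by (simp add: add_nonneg_pos)
  have "\<bar>z\<bar> ^ k / (fact k * Gamma (\<alpha> * real k + \<beta>)) \<le> \<bar>z\<bar> ^ k / (fact k * (exp (-2) / 2))"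
    using Gamma_real_lower_bound[OF pos] pos
    by (intro divide_left_mono mult_left_mono mult_pos_pos) auto
  then show "norm (norm (z ^ k / (fact k * Gamma (\<alpha> * real k + \<beta>))))
      \<le> (\<bar>z\<bar> ^ k /\<^sub>R fact k) * (2 * exp 2)"
    using pos Gamma_real_pos[OF pos]
    by (simp add: power_abs abs_mult exp_minus field_simps)
qed

lemma has_bochner_integral_weight_moment:
  fixes a b :: real and k :: nat
  assumes "0 < a" and "0 < b"
  shows "has_bochner_integral lborel
           (\<lambda>t. indicator {0..1} t *\<^sub>R ((1 - t powr (1 / a)) powr (b - 1) * t ^ k))
           (a * Beta (a * real k + a) b)"
proof -
  define f :: "real \<Rightarrow> real" where "f t = (1 - t powr (1 / a)) powr (b - 1) * t ^ k" for t
  \<comment> \<open>The interval is open because \<open>u powr a\<close> need not be differentiable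
    at 0; the endpoints do not affect the integral.\<close>
  define S :: "real set" where "S = {0<..<1}"
  have S: "S \<in> sets lebesgue"
    by (simp add: S_def)
  have p: "0 < a * real k + a"
    using assms by (simp add: add_nonneg_pos)
  have image: "(\<lambda>u. u powr a) ` S = S"
  proof (intro equalityI subsetI)
    fix t assume t: "t \<in> S"
    then have "t = (t powr (1 / a)) powr a"
      using assms by (simp add: S_def powr_powr)
    moreover have "t powr (1 / a) < 1"
      using t assms by (simp add: S_def powr01_less_one)
    ultimately show "t \<in> (\<lambda>u. u powr a) ` S"
      using t by (auto simp: S_def intro!: image_eqI[of _ _ "t powr (1 / a)"])
  qed (use assms in \<open>auto simp: S_def powr01_less_one\<close>)
  have inj: "inj_on (\<lambda>u. u powr a) S"
  proof (rule inj_on_inverseI)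
    show "(u powr a) powr (1 / a) = u" if "u \<in> S" for u
      using that assms by (simp add: S_def powr_powr)
  qed
  have deriv: "((\<lambda>u. u powr a) has_field_derivative a * u powr (a - 1)) (at u within S)"
    if "u \<in> S" for u
    using that by (auto simp: S_def intro!: derivative_eq_intros)
  have pullback: "\<bar>a * u powr (a - 1)\<bar> *\<^sub>R f (u powr a) =
      a * (u powr (a * real k + a - 1) * (1 - u) powr (b - 1))" if "u \<in> S" for u
  proof -
    have "u powr (a - 1) * (u powr a) ^ k = u powr (a * real k + a - 1)"
      using that by (simp add: S_def powr_powr algebra_simps flip: powr_realpow powr_add)
    moreover have "(u powr a) powr (1 / a) = u"
      using that assms by (simp add: S_def powr_powr)
    ultimately show ?thesis
      using assms by (simp add: f_def abs_mult mult_ac)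
  qed
  have "((\<lambda>u. a * (u powr (a * real k + a - 1) * (1 - u) powr (b - 1))) has_integral
      a * Beta (a * real k + a) b) S"
    using has_integral_Beta_real[OF p assms(2)]
    by (auto simp: S_def has_integral_Icc_iff_Ioo intro!: has_integral_mult_right)
  then have "((\<lambda>u. \<bar>a * u powr (a - 1)\<bar> *\<^sub>R f (u powr a)) has_integral
      a * Beta (a * real k + a) b) S"
    by (rule has_integral_eq[rotated]) (simp only: pullback)
  \<comment> \<open>The change of variables requires absolute integrability, which for a nonnegative
    integrand follows from gauge integrability.\<close>
  moreover from this have "(\<lambda>u. \<bar>a * u powr (a - 1)\<bar> *\<^sub>R f (u powr a)) absolutely_integrable_on S"
    by (intro nonnegative_absolutely_integrable_1) (auto simp: has_integral_iff f_def S_def)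
  ultimately have "f absolutely_integrable_on S \<and> integral S f = a * Beta (a * real k + a) b"
    using has_absolute_integral_change_of_variables_real[OF S deriv inj,
        where f = f and b = "a * Beta (a * real k + a) b"]
    unfolding image has_integral_iff by blast
  then have "(f has_integral a * Beta (a * real k + a) b) S"
    using set_lebesgue_integral_eq_integral(1) by (auto simp: has_integral_iff)
  then have "(f has_integral a * Beta (a * real k + a) b) {0..1}"
    by (simp add: S_def has_integral_Icc_iff_Ioo)
  moreover have nonneg: "0 \<le> f t" if "t \<in> {0..1}" for t
    using that by (simp add: f_def)
  \<comment> \<open>The nonnegative integral is the bridge from the gauge integral to the Bochner
    integral over \<open>lborel\<close>.\<close>
  ultimately have "(\<integral>\<^sup>+t. ennreal (indicator {0..1} t *\<^sub>R f t) \<partial>lborel) =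
      ennreal (a * Beta (a * real k + a) b)"
    using nn_integral_has_integral_lebesgue[of "{0..1}" f] by simp
  moreover have "0 \<le> a * Beta (a * real k + a) b"
    using assms p by (simp add: Beta_def)
  moreover have "(\<lambda>t. indicator {0..1} t *\<^sub>R f t) \<in> borel_measurable lborel"
    unfolding f_def by measurable
  ultimately have "has_bochner_integral lborel (\<lambda>t. indicator {0..1} t *\<^sub>R f t)
      (a * Beta (a * real k + a) b)"
    using nonneg by (intro has_bochner_integral_nn_integral) (auto simp: indicator_def)
  then show ?thesis
    by (simp add: f_def)
qed

text \<open>The Bochner form delivers integrability together with the value, so that both formulas
  of the theorem can be read off by specializing \<open>\<beta>\<close>.\<close>

lemma wright_integral:
  fixes \<alpha> \<beta> z :: real
  assumes "0 < \<alpha>" and "\<alpha> < \<beta>"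
  shows "has_bochner_integral lborel
           (\<lambda>t. indicator {0..1} t *\<^sub>R
             ((1 - t powr (1 / \<alpha>)) powr (\<beta> - \<alpha> - 1) * wright \<alpha> \<alpha> (z * t)))
           (\<alpha> * Gamma (\<beta> - \<alpha>) * wright \<alpha> \<beta> z)"
proof -
  define w :: "real \<Rightarrow> real" where "w t = (1 - t powr (1 / \<alpha>)) powr (\<beta> - \<alpha> - 1)" for t
  define c where "c x k = x ^ k / (fact k * Gamma (\<alpha> * real k + \<alpha>))" for x :: real and k
  define d where "d x k = x ^ k / (fact k * Gamma (\<alpha> * real k + \<beta>))" for x :: real and k
  define f where "f k t = indicator {0..1} t *\<^sub>R (w t * c (z * t) k)" for k and t :: real
  define C where "C = \<alpha> * Gamma (\<beta> - \<alpha>)"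
  have pos: "0 < \<alpha> * real k + \<alpha>" "0 < \<alpha> * real k + \<beta>" for k
    using assms by (simp_all add: add_nonneg_pos)
  have Beta: "c x k * (\<alpha> * Beta (\<alpha> * real k + \<alpha>) (\<beta> - \<alpha>)) = C * d x k" for x k
    using Gamma_real_pos[OF pos(1), of k] Gamma_real_pos[OF pos(2), of k]
    by (simp add: c_def d_def C_def Beta_def)
  \<comment> \<open>The point \<open>x\<close> is kept general: \<open>z\<close> gives the integrals
    of the terms, \<open>\<bar>z\<bar>\<close> those of their norms.\<close>
  have weighted_term: "has_bochner_integral lborel
      (\<lambda>t. indicator {0..1} t *\<^sub>R (w t * c (x * t) k)) (C * d x k)" for x k
  proof -
    have "has_bochner_integral lborel
        (\<lambda>t. c x k * (indicator {0..1} t *\<^sub>R (w t * t ^ k)))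
        (c x k * (\<alpha> * Beta (\<alpha> * real k + \<alpha>) (\<beta> - \<alpha>)))"
      unfolding w_def using assms
      by (intro has_bochner_integral_mult_right has_bochner_integral_weight_moment) auto
    moreover have "c x k * (indicator {0..1} t *\<^sub>R (w t * t ^ k)) =
        indicator {0..1} t *\<^sub>R (w t * c (x * t) k)" for t :: real
      by (simp add: c_def power_mult_distrib)
    ultimately show ?thesis
      by (simp only: Beta)
  qed
  have norm_f: "norm (f k t) = indicator {0..1} t *\<^sub>R (w t * c (\<bar>z\<bar> * t) k)" for k t
    using pos(1)[of k]
    by (auto simp: f_def w_def c_def abs_mult power_abs power_mult_distrib indicator_def)
  have summable_c: "summable (\<lambda>k. norm (c x k))" for x
    using summable_wright[OF assms(1) assms(1)] by (simp add: c_def)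
  have summable_d: "summable (d x)" for x
    using summable_wright[of \<alpha> \<beta> x] assms
    by (simp add: d_def[abs_def] summable_norm_cancel)
  have integrable: "integrable lborel (f k)" for k
    using weighted_term[of z k] unfolding f_def by (auto simp: has_bochner_integral_iff)
  have AE_summable: "AE t in lborel. summable (\<lambda>k. norm (f k t))"
  proof (rule AE_I2)
    fix t :: real
    have "summable (\<lambda>k. norm (indicator {0..1} t * w t) * norm (c (z * t) k))"
      by (intro summable_mult summable_c)
    then show "summable (\<lambda>k. norm (f k t))"
      by (simp add: f_def abs_mult mult_ac)
  qed
  \<comment> \<open>By \<open>norm_f\<close> these integrals are
    \<open>C * d \<bar>z\<bar> k\<close>, the terms of a convergent Wright series.\<close>
  have summable_integrals: "summable (\<lambda>k. \<integral>t. norm (f k t) \<partial>lborel)"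
    using summable_mult[OF summable_d, of C "\<bar>z\<bar>"]
      has_bochner_integral_integral_eq[OF weighted_term, of "\<bar>z\<bar>"]
    by (simp only: norm_f)
  have suminf: "(\<Sum>k. f k t) =
      indicator {0..1} t *\<^sub>R (w t * wright \<alpha> \<alpha> (z * t))" for t
    using suminf_mult[OF summable_norm_cancel[OF summable_c], of "indicator {0..1} t * w t" "z * t"]
    by (simp add: f_def wright_def c_def mult_ac)
  have "(\<integral>t. (\<Sum>k. f k t) \<partial>lborel) = (\<Sum>k. C * d z k)"
    using integral_suminf[OF integrable AE_summable summable_integrals]
      has_bochner_integral_integral_eq[OF weighted_term, of z] by (simp add: f_def)
  also have "\<dots> = C * wright \<alpha> \<beta> z"
    using suminf_mult[OF summable_d] by (simp add: wright_def d_def[abs_def])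
  finally show ?thesis
    using integrable_suminf[OF integrable AE_summable summable_integrals]
    by (simp add: has_bochner_integral_iff suminf w_def C_def)
qed

theorem lemma1:
  fixes \<alpha> \<beta> z :: real
  assumes "0 < \<alpha>" and "\<alpha> < \<beta>"
  shows "set_integrable lborel {0..1}
           (\<lambda>t. (1 - t powr (1 / \<alpha>)) powr (\<beta> - \<alpha> - 1) * wright \<alpha> \<alpha> (z * t))
       \<and> wright \<alpha> \<beta> z = 1 / (\<alpha> * Gamma (\<beta> - \<alpha>)) *
           (LBINT t:{0..1}. (1 - t powr (1 / \<alpha>)) powr (\<beta> - \<alpha> - 1) * wright \<alpha> \<alpha> (z * t))
       \<and> set_integrable lborel {0..1} (\<lambda>t. wright \<alpha> \<alpha> (z * t))
       \<and> wright \<alpha> (\<alpha> + 1) z = 1 / \<alpha> * (LBINT t:{0..1}. wright \<alpha> \<alpha> (z * t))"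
proof -
  have weight: "(1 - t powr (1 / \<alpha>)) powr (\<alpha> + 1 - \<alpha> - 1) = 1" if "t \<in> {0..<1}" for t :: real
  proof -
    have "t powr (1 / \<alpha>) < 1"
      using that assms by (cases "t = 0") (auto simp: powr01_less_one)
    then show ?thesis by simp
  qed
  \<comment> \<open>Changing an integrand almost everywhere over \<open>lborel\<close>, which is not
    complete, requires measurability of the new one.\<close>
  have meas: "wright \<alpha> \<alpha> \<in> borel_measurable borel"
    unfolding wright_def by measurable
  have "has_bochner_integral lborel (\<lambda>t. indicator {0..1} t *\<^sub>R wright \<alpha> \<alpha> (z * t))
      (\<alpha> * Gamma (\<alpha> + 1 - \<alpha>) * wright \<alpha> (\<alpha> + 1) z)"
  proof (rule has_bochner_integralI_AE[OF wright_integral])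
    \<comment> \<open>At \<open>t = 1\<close> the weight is \<open>0 powr 0 = 0\<close>, so the integrands differ there.\<close>
    show "AE t in lborel. indicator {0..1} t *\<^sub>R
        ((1 - t powr (1 / \<alpha>)) powr (\<alpha> + 1 - \<alpha> - 1) * wright \<alpha> \<alpha> (z * t)) =
        indicator {0..1} t *\<^sub>R wright \<alpha> \<alpha> (z * t)"
      using AE_lborel_singleton[of 1]
    proof eventually_elim
      case (elim t)
      then show ?case using weight[of t] by (auto simp: indicator_def)
    qed
    show "(\<lambda>t. indicator {0..1} t *\<^sub>R wright \<alpha> \<alpha> (z * t)) \<in> borel_measurable lborel"
      using meas by measurable
  qed (use assms in auto)
  moreover have "Gamma (\<beta> - \<alpha>) \<noteq> 0"
    using assms Gamma_real_pos[of "\<beta> - \<alpha>"] by linarith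
  ultimately show ?thesis
    using wright_integral[OF assms, of z] assms
    by (simp add: has_bochner_integral_iff set_integrable_def set_lebesgue_integral_def)
qed

end
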